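(* Let $K$ be an algebraically closed field with $\operatorname{char}(K)>3$, let $a,b\in K$ with $4a^3+27b^2\neq 0$, let $E=\{(x,y)\in K^2 \mid y^2=x^3+ax+b\}\cup\{O\}$, and let $+\colon E\times E\to E$ be the chord-and-tangent addition given by the explicit formulas in the context. Then $(E,+)$ is an abelian group with neutral element $O$.
   Context: $K$ is an algebraically closed field with $\operatorname{char}(K)>3$ and $a,b\in K$ satisfy $4a^3+27b^2\neq 0$. The (affine) elliptic curve is the set $E=\{(x,y)\in K^2 \mid y^2=x^3+ax+b\}\cup\{O\}$, where $O$ is a formal extra point (the "point at infinity"). For $A\in E\setminus\{O\}$ write $A=(x_A,y_A)$. The addition $+\colon E\times E\to E$ is defined as follows. (a) $A+O=O+A:=A$ for all $A\in E$. (b) For $A,B\in E\setminus\{O\}$ with $(x_A,y_A)=(x_B,-y_B)$, $A+B:=O$. (c) For $A,B\in E\setminus\{O\}$ with $(x_A,y_A)\neq(x_B,-y_B)$, $A+B:=(x_{AB},y_{AB})$ where $$x_{AB}:=\alpha(A,B)^2-x_A-x_B,\qquad y_{AB}:=-y_A+\alpha(A,B)(x_A-x_{AB}),$$ with $\alpha(A,B)=\frac{y_A-y_B}{x_A-x_B}$ if $x_A\neq x_B$, and $\alpha(A,B)=\frac{3x_A^2+a}{2y_B}$ if $x_A=x_B$. *)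

theory Defs
  imports "HOL-Algebra.Group" "HOL-Computational_Algebra.Polynomial"
begin

datatype 'a point = Infinity | Affine 'a 'a

definition elliptic_curve :: "'a::field \<Rightarrow> 'a \<Rightarrow> 'a point set" where
  "elliptic_curve a b = {Affine x y | x y. y\<^sup>2 = x ^ 3 + a * x + b} \<union> {Infinity}"

text \<open>
  The slope of the chord or tangent through two affine points. It is only used for points
  that are not negatives of each other; for such points of the curve with equal first
  coordinate, the denominator of the second branch is nonzero in characteristic other than 2.
\<close>

definition slope :: "'a::field \<Rightarrow> 'a \<Rightarrow> 'a \<Rightarrow> 'a \<Rightarrow> 'a \<Rightarrow> 'a" where
  "slope a xA yA xB yB =
    (if xA \<noteq> xB then (yA - yB) / (xA - xB) else (3 * xA\<^sup>2 + a) / (2 * yB))"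

text \<open>
  The formulas do not involve the coefficient \<open>b\<close>, so the addition is a total function on
  all points. That it maps pairs of points of the curve to the curve is part of the group
  property of the structure below.
\<close>

fun point_add :: "'a::field \<Rightarrow> 'a point \<Rightarrow> 'a point \<Rightarrow> 'a point" where
  "point_add a Infinity B = B"
| "point_add a A Infinity = A"
| "point_add a (Affine xA yA) (Affine xB yB) =
    (if (xA, yA) = (xB, - yB) then Infinity
     else let s = slope a xA yA xB yB;
              xAB = s\<^sup>2 - xA - xB;
              yAB = - yA + s * (xA - xAB)
          in Affine xAB yAB)"

definition elliptic_curve_group :: "'a::field \<Rightarrow> 'a \<Rightarrow> 'a point monoid" where
  "elliptic_curve_group a b =
    \<lparr>carrier = elliptic_curve a b, monoid.mult = point_add a, one = Infinity\<rparr>"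

end

theory Submission
  imports Defs
begin

text \<open>
  Associativity is the only difficulty. Let \<open>A, B, C\<close> be affine points, and let \<open>q\<close> be the
  polynomial of degree at most 2 with \<open>y = q(x)\<close> at \<open>A, B, C\<close> (tangent to the curve at a repeated
  point). The parabola \<open>y = q(x)\<close> meets the curve in a fourth point \<open>D\<close>, and in general
  \<open>(A + B) + C = - D\<close>. As \<open>q\<close> does not depend on the order of \<open>A, B, C\<close>, this gives associativity
  whenever all the sums involved are chords between points with distinct abscissae, except that
  \<open>A = B\<close> is allowed.
  So for fixed \<open>P, Q\<close> of the curve, \<open>(P + Q) + T = P + (Q + T)\<close> holds for all but finitely many
  \<open>T\<close>. Since \<open>E\<close> is infinite, for given \<open>P, Q, R\<close> there is a \<open>T\<close> with
  \<open>((P + Q) + R) + T = (P + Q) + (R + T) = P + (Q + (R + T)) = P + ((Q + R) + T) = (P + (Q + R)) + T\<close>,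
  and \<open>T\<close> can be cancelled.
\<close>

section \<open>Negation and the setting\<close>

fun point_neg :: "'a::field point \<Rightarrow> 'a point" where
  "point_neg Infinity = Infinity"
| "point_neg (Affine x y) = Affine x (- y)"

lemma point_neg_neg [simp]: "point_neg (point_neg P) = P"
  by (cases P) auto

locale nonsingular_weierstrass =
  fixes a b :: "'a::field"
  assumes two_nz: "(2::'a) \<noteq> 0"
    and disc_nz: "4 * a ^ 3 + 27 * b\<^sup>2 \<noteq> 0"
begin

abbreviation E :: "'a point set" where "E \<equiv> elliptic_curve a b"

abbreviation add :: "'a point \<Rightarrow> 'a point \<Rightarrow> 'a point"  (infixl "\<oplus>" 65)
  where "P \<oplus> Q \<equiv> point_add a P Q"

definition on_curve :: "'a \<Rightarrow> 'a \<Rightarrow> bool" where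
  "on_curve x y \<longleftrightarrow> y\<^sup>2 = x ^ 3 + a * x + b"

lemma Affine_in_E [simp]: "Affine x y \<in> E \<longleftrightarrow> on_curve x y"
  by (auto simp: elliptic_curve_def on_curve_def)

lemma Infinity_in_E [simp]: "Infinity \<in> E"
  by (simp add: elliptic_curve_def)

lemma neg_in_E: "P \<in> E \<Longrightarrow> point_neg P \<in> E"
  by (cases P) (auto simp: on_curve_def)

lemma add_Infinity_right [simp]: "P \<oplus> Infinity = P"
  by (cases P) auto

section \<open>Chords and tangents\<close>

text \<open>
  The slope \<open>s\<close> of the line through \<open>A\<close> and \<open>B\<close>, uniformly for chords and tangents: on the curve
  each equation implies the other if \<open>xA \<noteq> xB\<close>, and the second is the tangent condition if \<open>A = B\<close>.
\<close>

definition chord :: "'a \<Rightarrow> 'a \<Rightarrow> 'a \<Rightarrow> 'a \<Rightarrow> 'a \<Rightarrow> bool" where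
  "chord s xA yA xB yB \<longleftrightarrow>
     s * (xA - xB) = yA - yB \<and> s * (yA + yB) = xA\<^sup>2 + xA * xB + xB\<^sup>2 + a"

lemma same_x:
  assumes "on_curve x y" "on_curve x z" "y \<noteq> - z"
  shows "y = z"
  using assms unfolding on_curve_def by (metis power2_eq_iff)

lemma double_nz: "(y::'a) \<noteq> - y \<longleftrightarrow> y \<noteq> 0"
  using two_nz by (metis add.inverse_neutral add_eq_0_iff mult_2 mult_eq_0_iff)

text \<open>Subtracting the two curve equations and factoring out \<open>xA - xB\<close> turns the
  first chord equation into the second.\<close>

lemma chordI:
  assumes A: "on_curve xA yA" and B: "on_curve xB yB" and "xA \<noteq> xB"
    and s: "s * (xA - xB) = yA - yB"
  shows "chord s xA yA xB yB"
proof -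
  have "(xA - xB) * (s * (yA + yB)) = (xA - xB) * (xA\<^sup>2 + xA * xB + xB\<^sup>2 + a)"
    using s A B unfolding on_curve_def by algebra
  with s \<open>xA \<noteq> xB\<close> show ?thesis by (simp add: chord_def)
qed

lemma chord_slope:
  assumes A: "on_curve xA yA" and B: "on_curve xB yB" and ne: "(xA, yA) \<noteq> (xB, - yB)"
  shows "chord (slope a xA yA xB yB) xA yA xB yB"
proof (cases "xA = xB")
  case True
  then have y: "yA = yB" using same_x[of xA yA yB] A B ne by simp
  then have "yB \<noteq> 0" using ne True double_nz by auto
  with y True two_nz show ?thesis
    by (auto simp: chord_def slope_def divide_simps power2_eq_square)
next
  case False
  then show ?thesis using A B by (intro chordI) (simp_all add: slope_def)
qed

text \<open>The factors of \<open>s\<close> in the two chord equations, \<open>xA - xB\<close> and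
  \<open>yA + yB\<close>, do not both vanish unless the points are opposite.\<close>

lemma chord_unique:
  assumes "on_curve xA yA" "on_curve xB yB" "(xA, yA) \<noteq> (xB, - yB)"
    and "chord s xA yA xB yB"
  shows "slope a xA yA xB yB = s"
proof -
  have c: "chord (slope a xA yA xB yB) xA yA xB yB" using assms chord_slope by blast
  show ?thesis
  proof (cases "xA = xB")
    case True
    then have "yA + yB \<noteq> 0" using assms(3) by (simp add: add_eq_0_iff2)
    then show ?thesis using c assms(4) unfolding chord_def by (metis mult_right_cancel)
  next
    case False
    then have "xA - xB \<noteq> 0" by simp
    then show ?thesis using c assms(4) unfolding chord_def by (metis mult_right_cancel)
  qed
qed

lemma add_chord:
  assumes "on_curve xA yA" "on_curve xB yB" "(xA, yA) \<noteq> (xB, - yB)"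
    and "chord s xA yA xB yB"
  shows "Affine xA yA \<oplus> Affine xB yB =
    Affine (s\<^sup>2 - xA - xB) (- yA + s * (xA - (s\<^sup>2 - xA - xB)))"
  using chord_unique[OF assms] assms(3) by (simp add: Let_def)

lemma chord_exists:
  assumes "on_curve xA yA" "on_curve xB yB" "(xA, yA) \<noteq> (xB, - yB)"
  obtains s where "chord s xA yA xB yB"
  using chord_slope[OF assms] by blast

text \<open>Vieta: the cubic minus the square of the line has roots \<open>xA\<close>,
  \<open>xB\<close> and, by its quadratic coefficient, \<open>s\<^sup>2 - xA - xB\<close>. Tangents
  are included.\<close>

lemma chord_factor:
  assumes "on_curve xA yA" "on_curve xB yB" "chord s xA yA xB yB"
  shows "x ^ 3 + a * x + b =
    (yA + s * (x - xA))\<^sup>2 + (x - xA) * (x - xB) * (x - (s\<^sup>2 - xA - xB))"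
  using assms unfolding on_curve_def chord_def by algebra

section \<open>Closure, commutativity and negation\<close>

lemma add_closed:
  assumes "P \<in> E" "Q \<in> E"
  shows "P \<oplus> Q \<in> E"
proof (cases P)
  case P: (Affine xA yA)
  show ?thesis
  proof (cases Q)
    case Q: (Affine xB yB)
    show ?thesis
    proof (cases "(xA, yA) = (xB, - yB)")
      case False
      have A: "on_curve xA yA" and B: "on_curve xB yB" using assms P Q by auto
      obtain s where s: "chord s xA yA xB yB" using chord_exists A B False by blast
      show ?thesis
        using chord_factor[OF A B s, of "s\<^sup>2 - xA - xB"]
        unfolding P Q add_chord[OF A B False s] Affine_in_E on_curve_def by algebra
    qed (use P Q in auto)
  qed (use assms in auto)
qed (use assms in auto)

lemma chord_sym: "chord s xA yA xB yB \<longleftrightarrow> chord s xB yB xA yA"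
  unfolding chord_def by (auto; algebra)

lemma add_commute:
  assumes "P \<in> E" "Q \<in> E"
  shows "P \<oplus> Q = Q \<oplus> P"
proof (cases P)
  case P: (Affine xA yA)
  show ?thesis
  proof (cases Q)
    case Q: (Affine xB yB)
    show ?thesis
    proof (cases "(xA, yA) = (xB, - yB)")
      case False
      have A: "on_curve xA yA" and B: "on_curve xB yB" using assms P Q by auto
      have F: "(xB, yB) \<noteq> (xA, - yA)" using False by auto
      obtain s where s: "chord s xA yA xB yB" using chord_exists A B False by blast
      have "s * (xA - xB) = yA - yB" using s by (simp add: chord_def)
      \<comment> \<open>Both sides are minus the ordinate of the common line at
        \<open>x\<close>.\<close>
      then have "- yA + s * (xA - x) = - yB + s * (xB - x)" for x by algebra
      moreover have "s\<^sup>2 - xB - xA = s\<^sup>2 - xA - xB" by simp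
      ultimately show ?thesis
        unfolding P Q add_chord[OF A B False s]
          add_chord[OF B A F s[unfolded chord_sym[of s xA]]] point.inject
        by metis
    qed (use P Q in auto)
  qed (use P in auto)
qed (use assms in auto)

lemma neg_add:
  assumes "P \<in> E" "Q \<in> E"
  shows "point_neg (P \<oplus> Q) = point_neg P \<oplus> point_neg Q"
proof (cases P)
  case P: (Affine xA yA)
  show ?thesis
  proof (cases Q)
    case Q: (Affine xB yB)
    show ?thesis
    proof (cases "(xA, yA) = (xB, - yB)")
      case False
      have A: "on_curve xA yA" and B: "on_curve xB yB" using assms P Q by auto
      have A': "on_curve xA (- yA)" and B': "on_curve xB (- yB)"
        using A B by (auto simp: on_curve_def)
      have F: "(xA, - yA) \<noteq> (xB, - (- yB))" using False by auto
      obtain s where s: "chord s xA yA xB yB" using chord_exists A B False by blast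
      have s': "chord (- s) xA (- yA) xB (- yB)"
        using s unfolding chord_def by (auto; algebra)
      show ?thesis
        unfolding P Q add_chord[OF A B False s] point_neg.simps add_chord[OF A' B' F s']
        by simp
    qed (use P Q in auto)
  qed (use P in auto)
qed (use assms in auto)

lemma add_neg_self [simp]: "P \<oplus> point_neg P = Infinity"
  by (cases P) auto

section \<open>Nonsingularity and cancellation\<close>

text \<open>Otherwise \<open>x\<close> is a double root of the cubic, which forces its discriminant
  to vanish.\<close>

lemma nonsingular:
  assumes "on_curve x 0"
  shows "3 * x\<^sup>2 + a \<noteq> 0"
proof
  assume "3 * x\<^sup>2 + a = 0"
  then have "a = - 3 * x\<^sup>2" by algebra
  moreover have "x ^ 3 + a * x + b = 0" using assms by (simp add: on_curve_def)
  ultimately have "b = 2 * x ^ 3" by algebra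
  with \<open>a = - 3 * x\<^sup>2\<close> have "4 * a ^ 3 + 27 * b\<^sup>2 = 0" by algebra
  with disc_nz show False by simp
qed

text \<open>The line through \<open>P\<close> and \<open>Q\<close> also joins \<open>Q\<close> to
  its third intersection \<open>point_neg (P \<oplus> Q)\<close>, and then \<open>P\<close> is the
  remaining intersection.\<close>

lemma third_point:
  assumes P: "P \<in> E" and Q: "Q \<in> E"
  shows "point_neg (P \<oplus> Q) \<oplus> Q = point_neg P"
proof (cases P)
  case P': (Affine xA yA)
  show ?thesis
  proof (cases Q)
    case Q': (Affine xB yB)
    show ?thesis
    proof (cases "(xA, yA) = (xB, - yB)")
      case False
      have A: "on_curve xA yA" and B: "on_curve xB yB" using P Q P' Q' by auto
      obtain s where s: "chord s xA yA xB yB" using chord_exists A B False by blast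
      define x where "x = s\<^sup>2 - xA - xB"
      define y where "y = yA + s * (x - xA)"
      have sum: "P \<oplus> Q = Affine x (- y)"
        unfolding P' Q' add_chord[OF A B False s] x_def y_def
        by (simp add: algebra_simps)
      have C: "on_curve x y"
        using add_closed[OF P Q] unfolding sum by (simp add: on_curve_def)
      have c1: "s * (x - xB) = y - yB"
        using s unfolding chord_def y_def by algebra
      have c2: "s * (y + yB) = x\<^sup>2 + x * xB + xB\<^sup>2 + a"
        using s unfolding chord_def y_def x_def by algebra
      \<comment> \<open>If the third point were opposite to \<open>B\<close>, then \<open>c1\<close>
        would give \<open>yB = 0\<close> and \<open>c2\<close> a singular point.\<close>
      have ne: "(x, y) \<noteq> (xB, - yB)"
      proof
        assume eq: "(x, y) = (xB, - yB)"
        then have "yB = 0" using c1 double_nz[of yB] by auto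
        with eq c2 have "3 * xB\<^sup>2 + a = 0" by (simp add: power2_eq_square algebra_simps)
        with nonsingular[of xB] B \<open>yB = 0\<close> show False by simp
      qed
      have "chord s x y xB yB" using c1 c2 by (simp add: chord_def)
      from add_chord[OF C B ne this] have
        "Affine x y \<oplus> Affine xB yB = Affine xA (- y + s * (x - xA))"
        by (simp add: x_def)
      also have "- y + s * (x - xA) = - yA" by (simp add: y_def)
      finally show ?thesis unfolding sum by (simp add: P' Q')
    qed (use P' Q' in auto)
  qed (use P' in auto)
qed (use assms in \<open>cases Q; auto\<close>)

text \<open>This is \<open>third_point\<close> with both sides negated.\<close>

lemma add_neg_cancel:
  assumes "P \<in> E" "Q \<in> E"
  shows "(P \<oplus> Q) \<oplus> point_neg Q = P"
  using third_point[OF assms] neg_add[of "point_neg (P \<oplus> Q)" Q] assms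
  by (metis add_closed neg_in_E point_neg_neg)

lemma add_right_cancel:
  assumes "P \<in> E" "Q \<in> E" "R \<in> E" "P \<oplus> R = Q \<oplus> R"
  shows "P = Q"
  using assms add_neg_cancel by metis

section \<open>Associativity for generic triples\<close>

text \<open>
  \<open>C\<close> lies on the parabola \<open>y = q(x)\<close>, where \<open>q(x) = l(x) + k (x - xA) (x - xB)\<close> and \<open>l\<close> is the line
  \<open>AB\<close>. Dividing \<open>q\<^sup>2 - (x\<^sup>3 + a x + b)\<close> by \<open>(x - xA) (x - xB)\<close> leaves a quadratic whose roots are
  \<open>xC\<close> and the abscissa \<open>X\<close> of the fourth point; assumption \<open>key\<close> says that \<open>xC\<close> is a root.
\<close>

lemma add_add:
  assumes A: "on_curve xA yA" and B: "on_curve xB yB" and C: "on_curve xC yC"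
    and ne: "(xA, yA) \<noteq> (xB, - yB)" and s: "chord s xA yA xB yB"
    and interp: "yC = yA + s * (xC - xA) + k * (xC - xA) * (xC - xB)"
    and key: "k * (yC + yA + s * (xC - xA)) = xC - (s\<^sup>2 - xA - xB)"
    and gen: "xC \<noteq> s\<^sup>2 - xA - xB"
    and X: "X = (1 / k)\<^sup>2 - 2 * s / k + xA + xB - xC"
  shows "(Affine xA yA \<oplus> Affine xB yB) \<oplus> Affine xC yC =
    Affine X (- (yA + s * (X - xA) + k * (X - xA) * (X - xB)))"
proof -
  define e where "e = s\<^sup>2 - xA - xB"
  define y where "y = - yA + s * (xA - e)"
  define r where "r = 1 / k"
  have rk: "r * k = 1" using key gen by (auto simp: r_def)
  \<comment> \<open>Vieta for the quotient quadratic: its roots \<open>xC\<close> and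
    \<open>X\<close> have sum \<open>r\<^sup>2 - 2 * s * r + xA + xB\<close>.\<close>
  have X': "X = r\<^sup>2 - 2 * s * r + xA + xB - xC" using X by (simp add: r_def)
  have sum: "Affine xA yA \<oplus> Affine xB yB = Affine e y"
    using add_chord[OF A B ne s] by (simp only: e_def y_def)
  have D: "on_curve e y"
    using add_closed[of "Affine xA yA" "Affine xB yB"] A B by (simp only: sum Affine_in_E)
  have ne': "e \<noteq> xC" using gen by (simp add: e_def)
  have "yC + yA + s * (xC - xA) = r * (k * (yC + yA + s * (xC - xA)))"
    using rk by (simp add: mult.assoc[symmetric])
  then have W: "yC + yA + s * (xC - xA) = r * (xC - e)"
    using key by (simp only: e_def)
  then have "(r - s) * (e - xC) = y - yC"
    unfolding y_def by algebra
  \<comment> \<open>The line from \<open>A \<oplus> B\<close> to \<open>C\<close> has slope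
    \<open>1 / k - s\<close>.\<close>
  then have "chord (r - s) e y xC yC"
    by (intro chordI D C ne')
  from add_chord[OF D C _ this] ne'
  have "Affine e y \<oplus> Affine xC yC =
      Affine ((r - s)\<^sup>2 - e - xC) (- y + (r - s) * (e - ((r - s)\<^sup>2 - e - xC)))"
    by blast
  moreover have X2: "(r - s)\<^sup>2 - e - xC = X" unfolding X' e_def by algebra
  moreover have "k * (X + xC - xA - xB) = r - 2 * s"
    using rk unfolding X' by algebra
  with W interp have "- y + (r - s) * (e - X) = - (yA + s * (X - xA) + k * (X - xA) * (X - xB))"
    unfolding y_def by algebra
  ultimately show ?thesis by (simp only: sum)
qed

text \<open>The right side is a cyclic shift of the left, so \<open>add_add\<close> applies to both;
  the two Newton forms of the parabola yield the same fourth point.\<close>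

lemma affine_assoc:
  assumes A: "on_curve xA yA" and B: "on_curve xB yB" and C: "on_curve xC yC"
    and AB: "(xA, yA) \<noteq> (xB, - yB)" and BC: "(xB, yB) \<noteq> (xC, - yC)"
    and s: "chord s xA yA xB yB" and t: "chord t xB yB xC yC"
    and "xA \<noteq> xC" "xC \<noteq> s\<^sup>2 - xA - xB" "xA \<noteq> t\<^sup>2 - xB - xC"
  shows "(Affine xA yA \<oplus> Affine xB yB) \<oplus> Affine xC yC =
    (Affine xB yB \<oplus> Affine xC yC) \<oplus> Affine xA yA"
proof -
  \<comment> \<open>The second divided difference, the leading coefficient of the interpolating
    parabola.\<close>
  define k where "k = (t - s) / (xC - xA)"
  have nz: "xC - xA \<noteq> 0" using \<open>xA \<noteq> xC\<close> by simp
  have k: "k * (xC - xA) = t - s" using nz by (simp add: k_def)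
  note s12 = s[unfolded chord_def, THEN conjunct1] s[unfolded chord_def, THEN conjunct2]
  note t12 = t[unfolded chord_def, THEN conjunct1] t[unfolded chord_def, THEN conjunct2]
  have i1: "yC = yA + s * (xC - xA) + k * (xC - xA) * (xC - xB)"
    using k s12(1) t12(1) by algebra
  have i2: "yA = yB + t * (xA - xB) + k * (xA - xB) * (xA - xC)"
    using k s12(1) t12(1) by algebra
  have "(xC - xA) * (k * (yC + yA + s * (xC - xA))) = (xC - xA) * (xC - (s\<^sup>2 - xA - xB))"
    using k s12 t12 by algebra
  then have k1: "k * (yC + yA + s * (xC - xA)) = xC - (s\<^sup>2 - xA - xB)" using nz by simp
  have "(xC - xA) * (k * (yA + yB + t * (xA - xB))) = (xC - xA) * (xA - (t\<^sup>2 - xB - xC))"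
    using k s12 t12 by algebra
  then have k2: "k * (yA + yB + t * (xA - xB)) = xA - (t\<^sup>2 - xB - xC)" using nz by simp
  have "k \<noteq> 0" using k1 assms(9) by auto
  define r where "r = 1 / k"
  have rk: "r * k = 1" using \<open>k \<noteq> 0\<close> by (simp add: r_def)
  define X where "X = r\<^sup>2 - 2 * s * r + xA + xB - xC"
  have X1: "X = (1 / k)\<^sup>2 - 2 * s / k + xA + xB - xC" by (simp add: X_def r_def)
  have "r * (t - s) = xC - xA" using rk k by algebra
  then have "X = r\<^sup>2 - 2 * t * r + xB + xC - xA" unfolding X_def by algebra
  then have X2: "X = (1 / k)\<^sup>2 - 2 * t / k + xB + xC - xA" by (simp add: r_def)
  have "yA + s * (X - xA) + k * (X - xA) * (X - xB) =
        yB + t * (X - xB) + k * (X - xB) * (X - xC)"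
    using k s12(1) by algebra
  then show ?thesis
    using add_add[OF A B C AB s i1 k1 assms(9) X1] add_add[OF B C A BC t i2 k2 assms(10) X2]
    by simp
qed

lemma eq_or_neg:
  assumes "Affine x y \<in> E" "Affine x z \<in> E"
  shows "Affine x y = Affine x z \<or> Affine x y = point_neg (Affine x z)"
  using assms same_x by auto

text \<open>Affine points of the curve with equal abscissae are equal or opposite, so the six
  exclusions give the three abscissa conditions of \<open>affine_assoc\<close>. The degenerate cases
  follow from cancellation.\<close>

lemma generic_assoc:
  assumes P: "P \<in> E" and Q: "Q \<in> E" and T: "T \<in> E"
    and gen: "T \<noteq> P" "T \<noteq> point_neg P" "T \<noteq> P \<oplus> Q" "T \<noteq> point_neg (P \<oplus> Q)"
      "Q \<oplus> T \<noteq> P" "Q \<oplus> T \<noteq> point_neg P"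
  shows "(P \<oplus> Q) \<oplus> T = P \<oplus> (Q \<oplus> T)"
proof -
  consider "P = Infinity \<or> Q = Infinity \<or> T = Infinity" | "P = point_neg Q" | "Q = point_neg T"
    | "P \<noteq> Infinity" "Q \<noteq> Infinity" "T \<noteq> Infinity" "P \<noteq> point_neg Q" "Q \<noteq> point_neg T"
    by blast
  then show ?thesis
  proof cases
    case 1
    then show ?thesis by auto
  next
    case 2
    have "P \<oplus> (Q \<oplus> T) = (T \<oplus> Q) \<oplus> point_neg Q"
      using 2 P Q T by (metis add_closed add_commute)
    then show ?thesis using 2 add_neg_cancel[OF T Q] Q
      by (metis add_commute add_neg_self neg_in_E point_add.simps(1))
  next
    case 3
    then show ?thesis
      using add_neg_cancel[of P "point_neg T"] P T add_commute[OF Q T] neg_in_E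
      by simp
  next
    case 4
    then obtain xA yA xB yB xC yC where
      PQT: "P = Affine xA yA" "Q = Affine xB yB" "T = Affine xC yC"
      by (metis point.exhaust)
    have A: "on_curve xA yA" and B: "on_curve xB yB" and C: "on_curve xC yC"
      using P Q T PQT by auto
    have AB: "(xA, yA) \<noteq> (xB, - yB)" and BC: "(xB, yB) \<noteq> (xC, - yC)"
      using 4 PQT by auto
    obtain s where s: "chord s xA yA xB yB" using chord_exists A B AB by blast
    obtain t where t: "chord t xB yB xC yC" using chord_exists B C BC by blast
    have "xA \<noteq> xC" using gen(1,2) eq_or_neg[of xC yC yA] P T PQT by auto
    moreover have "xC \<noteq> s\<^sup>2 - xA - xB"
      using gen(3,4) add_closed[OF P Q] T eq_or_neg[of xC yC]
      unfolding PQT add_chord[OF A B AB s] by metis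
    moreover have "xA \<noteq> t\<^sup>2 - xB - xC"
      using gen(5,6) add_closed[OF Q T] P eq_or_neg[of xA] point_neg_neg
      unfolding PQT add_chord[OF B C BC t] by metis
    ultimately have "(P \<oplus> Q) \<oplus> T = (Q \<oplus> T) \<oplus> P"
      unfolding PQT by (intro affine_assoc[OF A B C AB BC s t])
    also have "\<dots> = P \<oplus> (Q \<oplus> T)" by (intro add_commute add_closed P Q T)
    finally show ?thesis .
  qed
qed

section \<open>From generic to full associativity\<close>

text \<open>Translation by \<open>Q\<close> is injective by cancellation.\<close>

lemma finite_translate_preimage:
  assumes "Q \<in> E" "finite F"
  shows "finite {T \<in> E. Q \<oplus> T \<in> F}"
proof -
  have "inj_on (\<lambda>T. Q \<oplus> T) {T \<in> E. Q \<oplus> T \<in> F}"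
    using assms(1) add_right_cancel[of _ _ Q] add_commute[of Q] by (intro inj_onI) auto
  moreover have "(\<lambda>T. Q \<oplus> T) ` {T \<in> E. Q \<oplus> T \<in> F} \<subseteq> F" by auto
  ultimately show ?thesis using assms(2) by (meson finite_imageD finite_subset)
qed

lemma finite_assoc_exceptions:
  assumes "P \<in> E" "Q \<in> E"
  shows "finite {T \<in> E. (P \<oplus> Q) \<oplus> T \<noteq> P \<oplus> (Q \<oplus> T)}"
proof (rule finite_subset)
  show "{T \<in> E. (P \<oplus> Q) \<oplus> T \<noteq> P \<oplus> (Q \<oplus> T)} \<subseteq>
    {P, point_neg P, P \<oplus> Q, point_neg (P \<oplus> Q)} \<union> {T \<in> E. Q \<oplus> T \<in> {P, point_neg P}}"
    using generic_assoc[OF assms] by blast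
  show "finite ({P, point_neg P, P \<oplus> Q, point_neg (P \<oplus> Q)} \<union> {T \<in> E. Q \<oplus> T \<in> {P, point_neg P}})"
    using finite_translate_preimage[OF assms(2), of "{P, point_neg P}"] by simp
qed

lemma add_assoc:
  assumes inf: "infinite E" and P: "P \<in> E" and Q: "Q \<in> E" and R: "R \<in> E"
  shows "(P \<oplus> Q) \<oplus> R = P \<oplus> (Q \<oplus> R)"
proof -
  define Ex where "Ex P Q = {T \<in> E. (P \<oplus> Q) \<oplus> T \<noteq> P \<oplus> (Q \<oplus> T)}" for P Q
  have fin: "finite (Ex P Q)" if "P \<in> E" "Q \<in> E" for P Q
    unfolding Ex_def using finite_assoc_exceptions that .
  \<comment> \<open>Each set collects the \<open>T\<close> that break one of the four equalities in
    the chain from \<open>((P \<oplus> Q) \<oplus> R) \<oplus> T\<close> to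
    \<open>(P \<oplus> (Q \<oplus> R)) \<oplus> T\<close>.\<close>
  have "finite (Ex (P \<oplus> Q) R \<union> Ex Q R \<union> Ex P (Q \<oplus> R) \<union> {T \<in> E. R \<oplus> T \<in> Ex P Q})"
    using P Q R by (simp add: fin add_closed finite_translate_preimage)
  with inf have "\<not> E \<subseteq> Ex (P \<oplus> Q) R \<union> Ex Q R \<union> Ex P (Q \<oplus> R) \<union> {T \<in> E. R \<oplus> T \<in> Ex P Q}"
    using finite_subset by blast
  then obtain T where T: "T \<in> E" and
    "T \<notin> Ex (P \<oplus> Q) R" "T \<notin> Ex Q R" "T \<notin> Ex P (Q \<oplus> R)" "R \<oplus> T \<notin> Ex P Q"
    by blast
  then have "((P \<oplus> Q) \<oplus> R) \<oplus> T = (P \<oplus> (Q \<oplus> R)) \<oplus> T"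
    using add_closed[OF R T] by (simp add: Ex_def)
  then show ?thesis
    using add_right_cancel[OF _ _ T] P Q R by (simp add: add_closed)
qed

lemma comm_group_elliptic_curve:
  assumes "infinite E"
  shows "comm_group (elliptic_curve_group a b)"
proof (rule comm_groupI)
  show "\<exists>Q\<in>carrier (elliptic_curve_group a b).
      Q \<otimes>\<^bsub>elliptic_curve_group a b\<^esub> P = \<one>\<^bsub>elliptic_curve_group a b\<^esub>"
    if "P \<in> carrier (elliptic_curve_group a b)" for P
    using that add_neg_self[of P] add_commute[of P "point_neg P"] neg_in_E[of P]
    by (auto simp: elliptic_curve_group_def intro!: bexI[of _ "point_neg P"])
  show "P \<otimes>\<^bsub>elliptic_curve_group a b\<^esub> Q = Q \<otimes>\<^bsub>elliptic_curve_group a b\<^esub> P"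
    if "P \<in> carrier (elliptic_curve_group a b)" "Q \<in> carrier (elliptic_curve_group a b)" for P Q
    using that by (simp add: elliptic_curve_group_def add_commute)
qed (use assms in \<open>auto simp: elliptic_curve_group_def add_closed add_assoc\<close>)

end

section \<open>Infinitude of the curve and conclusion\<close>

text \<open>Over a finite field, one plus the product of all \<open>x - c\<close> is nonconstant and
  takes only the value 1, so it has no root.\<close>

lemma infinite_UNIV_alg_closed_field: "infinite (UNIV :: 'a::alg_closed_field set)"
proof
  assume fin: "finite (UNIV :: 'a set)"
  define q where "q = (\<Prod>c\<in>(UNIV :: 'a set). [:- c, 1:])"
  have "degree q = card (UNIV :: 'a set)"
    unfolding q_def by (subst degree_prod_eq_sum_degree) auto
  then have "degree q > 0" using fin by (simp add: card_gt_0_iff)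
  then have "degree (1 + q) > 0" by (simp add: degree_add_eq_right)
  then obtain x where "poly (1 + q) x = 0" using alg_closed_imp_poly_has_root by blast
  moreover have "poly q x = 0" using fin by (simp add: q_def poly_prod)
  ultimately show False by simp
qed

lemma infinite_elliptic_curve:
  fixes a b :: "'a::alg_closed_field"
  shows "infinite (elliptic_curve a b)"
proof
  assume fin: "finite (elliptic_curve a b)"
  have "\<exists>y. y\<^sup>2 = x ^ 3 + a * x + b" for x
    using nth_root_exists[of 2] by simp
  \<comment> \<open>Square roots exist, so every field element is the abscissa of a point; the value
    0 at \<open>Infinity\<close> is arbitrary.\<close>
  then have "UNIV \<subseteq> (\<lambda>P. case P of Infinity \<Rightarrow> 0 | Affine x y \<Rightarrow> x) ` elliptic_curve a b"
    by (force simp: elliptic_curve_def image_iff)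
  with fin infinite_UNIV_alg_closed_field show False by (meson finite_imageI finite_subset)
qed

theorem theorem1p3:
  fixes a b :: "'a::alg_closed_field"
  assumes "CHAR('a) > 3"
    and "4 * a ^ 3 + 27 * b\<^sup>2 \<noteq> 0"
  shows "comm_group (elliptic_curve_group a b)"
proof -
  have "\<not> CHAR('a) dvd 2" using assms(1) by (auto dest: dvd_imp_le)
  then have "(2 :: 'a) \<noteq> 0" using of_nat_eq_0_iff_char_dvd[where ?'a = 'a, of 2] by simp
  then interpret nonsingular_weierstrass a b using assms(2) by unfold_locales
  show ?thesis by (intro comm_group_elliptic_curve infinite_elliptic_curve)
qed

end
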